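(* Every complete metric semilattice $\mathcal P=(P,+,0,1,d)$ is a complete metric lattice with $0$ and $1$ being the minimal and maximal elements, respectively, and $+$ being the lattice join operation. That is, with the order $x\le y\iff x+y=y$, every pair $x,y\in P$ has a greatest lower bound $xy$, and $(P,<,+,\cdot,0,1,d)$ is a complete metric lattice.
   Context: A metric semilattice is a structure $(P,+,0,1,d)$ where $(P,d)$ is a metric space, $0,1\in P$, $+$ is a commutative, associative, idempotent binary operation on $P$ with $0+x=x$ and $1+x=1$ for all $x$, and for all $x,y,z\in P$: (1) $d(1,0)=1$; (2) $d(x+z,y+z)\le d(x,y)$; (3) $d(x,y)\le d(x+y,0)+d(x+z,x)+d(y+z,y)-d(z,0)$. It is complete if $(P,d)$ is a complete metric space. A metric lattice is a tuple $(L,<,+,\cdot,0,1,d)$ where $(L,<)$ is a partially ordered set with minimal element $0$ and maximal element $1$; $+$ (join) and $\cdot$ (meet) are commutative, associative, idempotent; $x\le y$ iff $x+y=y$ iff $xy=x$; and $d$ is a metric on $L$ with $d(1,0)=1$, $d(x+z,y+z)\le d(x,y)$, and $d(x,y)\le d(x+y,0)-d(xy,0)$ for all $x,y,z\in L$. It is a complete metric lattice if $(L,d)$ is a complete metric space. *)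

theory Defs
  imports "HOL-Analysis.Analysis"
begin

text \<open>
  Structures live on a carrier set and all axioms are relativised to it. The locale
  \<^locale>\<open>Metric_space\<close> additionally asks the total function \<open>d\<close> to be symmetric and nonnegative
  off the carrier; this is a convention on the irrelevant values of \<open>d\<close>, since any metric on the
  carrier extends by \<open>0\<close>.
\<close>

locale metric_semilattice = Metric_space P d
  for P :: "'a set"
    and join :: "'a \<Rightarrow> 'a \<Rightarrow> 'a" (infixl "\<oplus>" 65)
    and zero :: 'a ("\<zero>")
    and one :: 'a ("\<one>")
    and d :: "'a \<Rightarrow> 'a \<Rightarrow> real" +
  assumes zero_closed: "\<zero> \<in> P"
    and one_closed: "\<one> \<in> P"
    and join_closed: "\<lbrakk>x \<in> P; y \<in> P\<rbrakk> \<Longrightarrow> x \<oplus> y \<in> P"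
    and join_commute: "\<lbrakk>x \<in> P; y \<in> P\<rbrakk> \<Longrightarrow> x \<oplus> y = y \<oplus> x"
    and join_assoc: "\<lbrakk>x \<in> P; y \<in> P; z \<in> P\<rbrakk> \<Longrightarrow> (x \<oplus> y) \<oplus> z = x \<oplus> (y \<oplus> z)"
    and join_idem: "x \<in> P \<Longrightarrow> x \<oplus> x = x"
    and zero_join: "x \<in> P \<Longrightarrow> \<zero> \<oplus> x = x"
    and one_join: "x \<in> P \<Longrightarrow> \<one> \<oplus> x = \<one>"
    and dist_one_zero: "d \<one> \<zero> = 1"
    and dist_join_le: "\<lbrakk>x \<in> P; y \<in> P; z \<in> P\<rbrakk> \<Longrightarrow> d (x \<oplus> z) (y \<oplus> z) \<le> d x y"
    and dist_le: "\<lbrakk>x \<in> P; y \<in> P; z \<in> P\<rbrakk> \<Longrightarrow>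
      d x y \<le> d (x \<oplus> y) \<zero> + d (x \<oplus> z) x + d (y \<oplus> z) y - d z \<zero>"

locale complete_metric_semilattice = metric_semilattice +
  assumes mcomplete: mcomplete

text \<open>
  The order is given by its reflexive relation \<open>r\<close>, i.e. \<open>(x, y) \<in> r\<close> means \<open>x \<le> y\<close>. The minimal and
  maximal elements of the order are understood as its least and greatest elements.
\<close>

locale metric_lattice = Metric_space L d
  for L :: "'a set"
    and r :: "'a rel"
    and join :: "'a \<Rightarrow> 'a \<Rightarrow> 'a" (infixl "\<oplus>" 65)
    and meet :: "'a \<Rightarrow> 'a \<Rightarrow> 'a" (infixl "\<odot>" 70)
    and zero :: 'a ("\<zero>")
    and one :: 'a ("\<one>")
    and d :: "'a \<Rightarrow> 'a \<Rightarrow> real" +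
  assumes partial_order: "partial_order_on L r"
    and zero_closed: "\<zero> \<in> L"
    and one_closed: "\<one> \<in> L"
    and zero_least: "x \<in> L \<Longrightarrow> (\<zero>, x) \<in> r"
    and one_greatest: "x \<in> L \<Longrightarrow> (x, \<one>) \<in> r"
    and join_closed: "\<lbrakk>x \<in> L; y \<in> L\<rbrakk> \<Longrightarrow> x \<oplus> y \<in> L"
    and join_commute: "\<lbrakk>x \<in> L; y \<in> L\<rbrakk> \<Longrightarrow> x \<oplus> y = y \<oplus> x"
    and join_assoc: "\<lbrakk>x \<in> L; y \<in> L; z \<in> L\<rbrakk> \<Longrightarrow> (x \<oplus> y) \<oplus> z = x \<oplus> (y \<oplus> z)"
    and join_idem: "x \<in> L \<Longrightarrow> x \<oplus> x = x"
    and meet_closed: "\<lbrakk>x \<in> L; y \<in> L\<rbrakk> \<Longrightarrow> x \<odot> y \<in> L"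
    and meet_commute: "\<lbrakk>x \<in> L; y \<in> L\<rbrakk> \<Longrightarrow> x \<odot> y = y \<odot> x"
    and meet_assoc: "\<lbrakk>x \<in> L; y \<in> L; z \<in> L\<rbrakk> \<Longrightarrow> (x \<odot> y) \<odot> z = x \<odot> (y \<odot> z)"
    and meet_idem: "x \<in> L \<Longrightarrow> x \<odot> x = x"
    and le_iff_join: "\<lbrakk>x \<in> L; y \<in> L\<rbrakk> \<Longrightarrow> (x, y) \<in> r \<longleftrightarrow> x \<oplus> y = y"
    and le_iff_meet: "\<lbrakk>x \<in> L; y \<in> L\<rbrakk> \<Longrightarrow> (x, y) \<in> r \<longleftrightarrow> x \<odot> y = x"
    and dist_one_zero: "d \<one> \<zero> = 1"
    and dist_join_le: "\<lbrakk>x \<in> L; y \<in> L; z \<in> L\<rbrakk> \<Longrightarrow> d (x \<oplus> z) (y \<oplus> z) \<le> d x y"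
    and dist_le: "\<lbrakk>x \<in> L; y \<in> L\<rbrakk> \<Longrightarrow> d x y \<le> d (x \<oplus> y) \<zero> - d (x \<odot> y) \<zero>"

locale complete_metric_lattice = metric_lattice +
  assumes mcomplete: mcomplete

definition join_order :: "'a set \<Rightarrow> ('a \<Rightarrow> 'a \<Rightarrow> 'a) \<Rightarrow> 'a rel" where
  "join_order P join = {(x, y). x \<in> P \<and> y \<in> P \<and> join x y = y}"

definition is_glb :: "'a rel \<Rightarrow> 'a \<Rightarrow> 'a \<Rightarrow> 'a \<Rightarrow> bool" where
  "is_glb r x y m \<longleftrightarrow>
    (m, x) \<in> r \<and> (m, y) \<in> r \<and> (\<forall>w. (w, x) \<in> r \<and> (w, y) \<in> r \<longrightarrow> (w, m) \<in> r)"

end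

theory Submission
  imports Defs
begin

text \<open>
  Write \<open>|x|\<close> for the distance from \<open>x\<close> to \<open>\<zero>\<close>. The third metric axiom with \<open>z = x\<close> says that
  \<open>d x y \<le> |y| - |x|\<close> whenever \<open>x \<le> y\<close>, so along the order the metric is the difference of heights
  (\<open>dist_of_le\<close>). Hence a nonempty set closed under joins behaves like a bounded increasing
  sequence: elements whose heights are nearly maximal are close to each other, because each is close
  to their join. By completeness such elements converge, and if the set is also topologically closed,
  the limit is a greatest element (\<open>closed_directed_has_greatest\<close>).

  The common lower bounds of \<open>x\<close> and \<open>y\<close> form a set of this kind: it contains \<open>\<zero>\<close>, is closed under
  joins, and is topologically closed since joins are continuous. Its greatest element is the meet.
  The lattice inequality \<open>d x y \<le> |x \<oplus> y| - |x \<odot> y|\<close> is then the third metric axiom with \<open>z\<close>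
  the meet, as both correction terms vanish for a common lower bound. The remaining
  lattice laws are order theory.
\<close>

context metric_semilattice
begin

lemma join_left_idem: "\<lbrakk>x \<in> P; y \<in> P\<rbrakk> \<Longrightarrow> x \<oplus> (x \<oplus> y) = x \<oplus> y"
  by (metis join_assoc join_idem)

lemma partial_order_join_order: "partial_order_on P (join_order P (\<oplus>))"
proof -
  have "x \<oplus> z = z" if "x \<in> P" "y \<in> P" "z \<in> P" "x \<oplus> y = y" "y \<oplus> z = z" for x y z
    using that by (metis join_assoc)
  then have "trans (join_order P (\<oplus>))"
    unfolding trans_def join_order_def by blast
  moreover have "antisym (join_order P (\<oplus>))"
    unfolding antisym_def join_order_def by (auto, metis join_commute)
  ultimately show ?thesis
    unfolding partial_order_on_def preorder_on_def refl_on_def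
    by (auto simp: join_order_def join_idem)
qed

lemma dist_of_le:
  assumes "x \<in> P" "y \<in> P" "x \<oplus> y = y"
  shows "d x y = d y \<zero> - d x \<zero>"
proof (rule antisym)
  have "y \<oplus> x = y"
    using assms join_commute by metis
  then show "d x y \<le> d y \<zero> - d x \<zero>"
    using dist_le[of x y x] assms join_idem by simp
  show "d y \<zero> - d x \<zero> \<le> d x y"
    using triangle[of y x \<zero>] assms zero_closed commute[of x y] by simp
qed

lemma height_le_one: "x \<in> P \<Longrightarrow> d x \<zero> \<le> 1"
  using dist_of_le[of x \<one>] join_commute[of x \<one>] one_closed one_join dist_one_zero
    nonneg[of x \<one>] by simp

text \<open>
  The hypothesis on \<open>s\<close> is applied to the join \<open>x \<oplus> y\<close>, whose height exceeds those of \<open>x\<close> and \<open>y\<close> by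
  its distances to them.
\<close>
lemma dist_le_height_gaps:
  assumes "x \<in> P" "y \<in> P" "d (x \<oplus> y) \<zero> \<le> s"
  shows "d x y \<le> (s - d x \<zero>) + (s - d y \<zero>)"
proof -
  have "d x (x \<oplus> y) = d (x \<oplus> y) \<zero> - d x \<zero>"
    using assms by (intro dist_of_le) (auto simp: join_closed join_left_idem)
  moreover have "d y (x \<oplus> y) = d (x \<oplus> y) \<zero> - d y \<zero>"
    using assms join_commute[of x y]
    by (intro dist_of_le) (auto simp: join_closed join_left_idem)
  moreover have "d x y \<le> d x (x \<oplus> y) + d y (x \<oplus> y)"
    using triangle[of x "x \<oplus> y" y] assms commute[of y "x \<oplus> y"] join_closed by simp
  ultimately show ?thesis
    using assms(3) by linarith
qed

text \<open>Joining with \<open>x\<close> is 1-Lipschitz, so the equation defining \<open>z \<le> x\<close> survives limits.\<close>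
lemma closedin_lower_set:
  assumes "x \<in> P"
  shows "closedin mtopology {z \<in> P. z \<oplus> x = x}"
proof (subst metric_closedin_iff_sequentially_closed, intro conjI allI impI)
  fix \<sigma> l
  assume A: "range \<sigma> \<subseteq> {z \<in> P. z \<oplus> x = x} \<and> limitin mtopology \<sigma> l sequentially"
  have l: "l \<in> P"
    using A limitin_mspace by blast
  have "d (l \<oplus> x) x \<le> e" if "e > 0" for e
  proof -
    obtain n where n: "d (\<sigma> n) l < e"
      using A \<open>e > 0\<close> unfolding limitin_metric eventually_sequentially by blast
    have \<sigma>: "\<sigma> n \<in> P" "\<sigma> n \<oplus> x = x"
      using A by auto
    have "d (l \<oplus> x) x \<le> d (\<sigma> n) l"
      using dist_join_le[OF l \<sigma>(1) assms] \<sigma>(2) commute[of "\<sigma> n" l] by simp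
    then show ?thesis
      using n by linarith
  qed
  then have "d (l \<oplus> x) x = 0"
    using field_le_epsilon[of "d (l \<oplus> x) x" 0] nonneg[of "l \<oplus> x" x] by force
  then show "l \<in> {z \<in> P. z \<oplus> x = x}"
    using l assms join_closed by auto
qed auto

end

context complete_metric_semilattice
begin

text \<open>
  The greatest element is the limit of elements of \<open>S\<close> whose heights tend to the supremum \<open>s\<close>: the
  limit \<open>l\<close> has height at least \<open>s\<close>, and joining \<open>l\<close> with any \<open>w \<in> S\<close> cannot raise it above \<open>s\<close>,
  so \<open>w \<oplus> l\<close> is at distance \<open>0\<close> from \<open>l\<close>.
\<close>
lemma closed_directed_has_greatest:
  assumes S: "closedin mtopology S" "S \<noteq> {}"
    and joins: "\<And>x y. \<lbrakk>x \<in> S; y \<in> S\<rbrakk> \<Longrightarrow> x \<oplus> y \<in> S"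
  obtains l where "l \<in> S" "\<And>w. w \<in> S \<Longrightarrow> w \<oplus> l = l"
proof -
  have SP: "S \<subseteq> P"
    using closedin_subset[OF S(1)] by simp
  define s where "s = (SUP x\<in>S. d x \<zero>)"
  have bdd: "bdd_above ((\<lambda>x. d x \<zero>) ` S)"
    using height_le_one SP by (intro bdd_aboveI[of _ 1]) auto
  have le_s: "d x \<zero> \<le> s" if "x \<in> S" for x
    unfolding s_def using that bdd by (rule cSUP_upper)
  have "\<exists>x\<in>S. s - inverse (real (Suc n)) < d x \<zero>" for n
  proof -
    have "s - inverse (real (Suc n)) < (SUP x\<in>S. d x \<zero>)"
      by (simp add: s_def)
    then show ?thesis
      using less_cSUP_iff[OF S(2) bdd] by blast
  qed
  then obtain \<sigma> where \<sigma>: "\<And>n. \<sigma> n \<in> S" and near: "\<And>n. s - inverse (real (Suc n)) < d (\<sigma> n) \<zero>"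
    by metis
  have \<sigma>P: "\<sigma> n \<in> P" for n
    using \<sigma> SP by blast
  have "MCauchy \<sigma>"
    unfolding MCauchy_def
  proof (intro conjI allI impI)
    show "range \<sigma> \<subseteq> P"
      using \<sigma>P by blast
    fix e :: real
    assume "e > 0"
    then obtain N where N: "inverse (real (Suc N)) < e / 2"
      using reals_Archimedean[of "e / 2"] by auto
    have gap: "s - d (\<sigma> n) \<zero> < e / 2" if "N \<le> n" for n
    proof -
      have "inverse (real (Suc n)) \<le> inverse (real (Suc N))"
        using that by (intro le_imp_inverse_le) auto
      then show ?thesis
        using near[of n] N by linarith
    qed
    have "d (\<sigma> m) (\<sigma> n) < e" if "N \<le> m" "N \<le> n" for m n
      using dist_le_height_gaps[OF \<sigma>P[of m] \<sigma>P[of n] le_s[OF joins[OF \<sigma> \<sigma>]]]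
        gap[OF that(1)] gap[OF that(2)] by linarith
    then show "\<exists>N. \<forall>n n'. N \<le> n \<longrightarrow> N \<le> n' \<longrightarrow> d (\<sigma> n) (\<sigma> n') < e"
      by blast
  qed
  then obtain l where lim: "limitin mtopology \<sigma> l sequentially"
    using mcomplete unfolding mcomplete_def by blast
  have lS: "l \<in> S"
    using S(1) lim \<sigma> unfolding metric_closedin_iff_sequentially_closed by blast
  then have lP: "l \<in> P"
    using SP by blast
  have "s \<le> d l \<zero> + e" if "e > 0" for e
  proof -
    obtain N1 where N1: "\<And>n. N1 \<le> n \<Longrightarrow> d (\<sigma> n) l < e / 2"
      using lim \<open>e > 0\<close> unfolding limitin_metric eventually_sequentially
      by (meson half_gt_zero)
    obtain N2 where N2: "inverse (real (Suc N2)) < e / 2"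
      using reals_Archimedean[of "e / 2"] \<open>e > 0\<close> by auto
    define n where "n = max N1 N2"
    have "inverse (real (Suc n)) \<le> inverse (real (Suc N2))"
      unfolding n_def by (intro le_imp_inverse_le) auto
    moreover have "d (\<sigma> n) l < e / 2"
      by (rule N1) (simp add: n_def)
    moreover have "d (\<sigma> n) \<zero> \<le> d (\<sigma> n) l + d l \<zero>"
      using \<sigma>P lP zero_closed by (rule triangle)
    ultimately show ?thesis
      using near[of n] N2 by linarith
  qed
  then have s_le: "s \<le> d l \<zero>"
    by (rule field_le_epsilon)
  show thesis
  proof
    show "l \<in> S"
      by (rule lS)
    fix w
    assume w: "w \<in> S"
    then have wP: "w \<in> P"
      using SP by blast
    have "d l (l \<oplus> w) = d (l \<oplus> w) \<zero> - d l \<zero>"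
      using lP wP by (intro dist_of_le) (auto simp: join_closed join_left_idem)
    also have "\<dots> \<le> 0"
      using le_s[OF joins[OF lS w]] s_le by linarith
    finally have "d l (l \<oplus> w) = 0"
      using nonneg[of l "l \<oplus> w"] by linarith
    then show "w \<oplus> l = l"
      using lP wP join_closed[OF lP wP] zero[of l "l \<oplus> w"] join_commute[of w l] by simp
  qed
qed

lemma glb_exists:
  assumes "x \<in> P" "y \<in> P"
  shows "\<exists>m. is_glb (join_order P (\<oplus>)) x y m"
proof -
  define S where "S = {z \<in> P. z \<oplus> x = x} \<inter> {z \<in> P. z \<oplus> y = y}"
  have "closedin mtopology S"
    unfolding S_def using assms by (intro closedin_Int closedin_lower_set)
  moreover have "S \<noteq> {}"
    using assms zero_closed zero_join unfolding S_def by blast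
  moreover have "u \<oplus> v \<in> S" if "u \<in> S" "v \<in> S" for u v
    using that assms by (auto simp: S_def join_closed join_assoc)
  ultimately obtain m where "m \<in> S" "\<And>w. w \<in> S \<Longrightarrow> w \<oplus> m = m"
    by (rule closed_directed_has_greatest) auto
  then have "is_glb (join_order P (\<oplus>)) x y m"
    using assms by (auto simp: is_glb_def join_order_def S_def)
  then show ?thesis
    by blast
qed

lemma complete_metric_lattice_of_glb:
  assumes glb: "\<And>x y. \<lbrakk>x \<in> P; y \<in> P\<rbrakk> \<Longrightarrow> is_glb (join_order P (\<oplus>)) x y (meet x y)"
  shows "complete_metric_lattice P (join_order P (\<oplus>)) (\<oplus>) meet \<zero> \<one> d"
proof -
  let ?r = "join_order P (\<oplus>)"
  note [simp] = zero_closed one_closed join_closed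
  have refl: "(x, x) \<in> ?r" if "x \<in> P" for x
    using that by (simp add: join_order_def join_idem)
  have anti: "x = y" if "(x, y) \<in> ?r" "(y, x) \<in> ?r" for x y
    using that partial_order_join_order unfolding partial_order_on_def antisym_def by blast
  have tr: "(x, z) \<in> ?r" if "(x, y) \<in> ?r" "(y, z) \<in> ?r" for x y z
    using that partial_order_join_order
    unfolding partial_order_on_def preorder_on_def trans_def by blast
  have m1: "(meet x y, x) \<in> ?r" and m2: "(meet x y, y) \<in> ?r" if "x \<in> P" "y \<in> P" for x y
    using glb[OF that] by (auto simp: is_glb_def)
  have m3: "(w, meet x y) \<in> ?r" if "x \<in> P" "y \<in> P" "(w, x) \<in> ?r" "(w, y) \<in> ?r" for w x y
    using glb[OF that(1,2)] that by (auto simp: is_glb_def)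
  have closed: "meet x y \<in> P" if "x \<in> P" "y \<in> P" for x y
    using m1[OF that] by (simp add: join_order_def)
  show ?thesis
  proof
    show "partial_order_on P ?r"
      by (rule partial_order_join_order)
    show "mcomplete"
      by (rule mcomplete)
    show "d \<one> \<zero> = 1" "\<zero> \<in> P" "\<one> \<in> P"
      by (simp_all add: dist_one_zero)
  next
    fix x
    assume x: "x \<in> P"
    then show "(\<zero>, x) \<in> ?r" "(x, \<one>) \<in> ?r" "x \<oplus> x = x"
      using join_commute[of x \<one>]
      by (simp_all add: join_order_def zero_join one_join join_idem)
    show "meet x x = x"
      using x by (intro anti m1 m3 refl)
  next
    fix x y
    assume xy: "x \<in> P" "y \<in> P"
    then show "x \<oplus> y \<in> P" "x \<oplus> y = y \<oplus> x" "meet x y \<in> P"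
      by (auto intro: join_commute closed)
    show "meet x y = meet y x"
      using xy by (intro anti m3 m1 m2)
    show "(x, y) \<in> ?r \<longleftrightarrow> x \<oplus> y = y"
      using xy by (simp add: join_order_def)
    show "(x, y) \<in> ?r \<longleftrightarrow> meet x y = x"
      using xy m1 m2 m3 anti refl by metis
    \<comment> \<open>These equations make both correction terms of the third metric axiom vanish.\<close>
    have "x \<oplus> meet x y = x" "y \<oplus> meet x y = y"
      using m1[OF xy] m2[OF xy] join_commute[OF xy(1) closed[OF xy]]
        join_commute[OF xy(2) closed[OF xy]] by (simp_all add: join_order_def)
    then show "d x y \<le> d (x \<oplus> y) \<zero> - d (meet x y) \<zero>"
      using dist_le[of x y "meet x y"] xy closed[OF xy] by simp
  next
    fix x y z
    assume xyz: "x \<in> P" "y \<in> P" "z \<in> P"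
    then show "x \<oplus> y \<oplus> z = x \<oplus> (y \<oplus> z)" "d (x \<oplus> z) (y \<oplus> z) \<le> d x y"
      by (auto intro: join_assoc dist_join_le)
    show "meet (meet x y) z = meet x (meet y z)"
      using xyz by (intro anti m3) (auto intro: closed m1 m2 tr[OF m1] tr[OF m2])
  qed
qed

end

theorem proposition3p29:
  fixes P :: "'a set"
    and join :: "'a \<Rightarrow> 'a \<Rightarrow> 'a"
    and zero one :: 'a
    and d :: "'a \<Rightarrow> 'a \<Rightarrow> real"
  assumes "complete_metric_semilattice P join zero one d"
  shows "\<exists>meet.
    (\<forall>x\<in>P. \<forall>y\<in>P. is_glb (join_order P join) x y (meet x y)) \<and>
    complete_metric_lattice P (join_order P join) join meet zero one d"
proof -
  interpret complete_metric_semilattice P join zero one d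
    by (rule assms)
  obtain meet where "\<And>x y. \<lbrakk>x \<in> P; y \<in> P\<rbrakk> \<Longrightarrow> is_glb (join_order P join) x y (meet x y)"
    using glb_exists by metis
  then show ?thesis
    using complete_metric_lattice_of_glb by blast
qed

end
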